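(* Let $m\ge 5$ be an integer and let $L_m$ be the ladder graph with $2$ rows and $m$ columns. Then $\mathrm{mpd}(L_m)=4$.
   Context: The ladder graph $L_m$ has vertex set $\{(x,y):x\in\{1,2\},\ 1\le y\le m\}$, with $(x,y)$ and $(x',y')$ adjacent if and only if $|x-x'|+|y-y'|=1$. $d(u,v)$ denotes the shortest-path distance. Let $G$ be a connected graph and let $\Pi=\{S_1,\dots,S_t\}$ be a partition of $V(G)$ into nonempty parts. For $v\in V(G)$ put $d(v,S_i)=\min\{d(v,x):x\in S_i\}$. The multiset partition representation of $v$ with respect to $\Pi$ is the multiset $r_{mp}(v\mid\Pi)=\{d(v,S_1),\dots,d(v,S_t)\}$ (order ignored, multiplicities kept). $\Pi$ is a resolving multiset partition if $r_{mp}(u\mid\Pi)\ne r_{mp}(v\mid\Pi)$ for all distinct $u,v\in V(G)$. The multiset partition dimension $\mathrm{mpd}(G)$ is the minimum number $t$ of parts of a resolving multiset partition of $G$, and $\mathrm{mpd}(G)=\infty$ if none exists. *)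

theory Defs
  imports
    "Graph_Theory.Graph_Theory"
    "HOL-Library.Multiset"
    "HOL-Library.Disjoint_Sets"
    "HOL-Library.Extended_Nat"
begin

text \<open>The locale \<open>graph\<close> provides finite simple undirected graphs, encoded as symmetric
  digraphs without loops or parallel arcs.\<close>

locale connected_graph = graph G for G :: "('a, 'b) pre_digraph" (structure) +
  assumes connected: "connected G"
begin

definition vdist :: "'a \<Rightarrow> 'a \<Rightarrow> ereal" where
  "vdist u v = \<mu> (\<lambda>_. 1) u v"

text \<open>\<open>Min\<close> is used only for nonempty finite \<open>S\<close>.\<close>

definition set_dist :: "'a \<Rightarrow> 'a set \<Rightarrow> ereal" where
  "set_dist v S = Min (vdist v ` S)"

text \<open>\<open>mset_set P\<close> lists every part once, while \<open>image_mset\<close> keeps the multiplicities of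
  coinciding distances.\<close>

definition mp_representation :: "'a set set \<Rightarrow> 'a \<Rightarrow> ereal multiset" where
  "mp_representation P v = image_mset (set_dist v) (mset_set P)"

definition resolving_multiset_partition :: "'a set set \<Rightarrow> bool" where
  "resolving_multiset_partition P \<longleftrightarrow>
     finite P \<and> partition_on (verts G) P \<and>
     (\<forall>u \<in> verts G. \<forall>v \<in> verts G. u \<noteq> v \<longrightarrow>
        mp_representation P u \<noteq> mp_representation P v)"

text \<open>The infimum over the empty set is \<open>\<infinity>\<close> in \<open>enat\<close>, and a nonempty set of extended
  natural numbers attains its infimum.\<close>

definition mpd :: enat where
  "mpd = (INF P \<in> {P. resolving_multiset_partition P}. enat (card P))"

end

definition ladder :: "nat \<Rightarrow> (nat \<times> nat) pair_pre_digraph" where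
  "ladder m = (let V = {(x, y). x \<in> {1, 2} \<and> 1 \<le> y \<and> y \<le> m} in
     \<lparr> pverts = V,
       parcs = {((x, y), (x', y')) | x y x' y'.
         (x, y) \<in> V \<and> (x', y') \<in> V \<and>
         \<bar>int x - int x'\<bar> + \<bar>int y - int y'\<bar> = 1} \<rparr>)"

lemma pverts_ladder: "pverts (ladder m) = {1, 2} \<times> {1..m}"
  by (auto simp: ladder_def Let_def)

lemma parcs_ladder:
  "((x, y), (x', y')) \<in> parcs (ladder m) \<longleftrightarrow>
     (x, y) \<in> pverts (ladder m) \<and> (x', y') \<in> pverts (ladder m) \<and>
     \<bar>int x - int x'\<bar> + \<bar>int y - int y'\<bar> = 1"
  by (auto simp: ladder_def Let_def)

lemma pair_graph_ladder: "pair_graph (ladder m)"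
proof
  have "parcs (ladder m) \<subseteq> pverts (ladder m) \<times> pverts (ladder m)"
    by (auto simp: ladder_def Let_def)
  then show "finite (parcs (ladder m))"
    by (rule finite_subset) (simp add: pverts_ladder)
  show "finite (pverts (ladder m))"
    by (simp add: pverts_ladder)
  show "symmetric (with_proj (ladder m))"
    by (auto simp: symmetric_def parcs_ladder intro!: symI)
qed (auto simp: parcs_ladder split_paired_all)

lemma connected_graph_ladder:
  assumes "m \<ge> 1"
  shows "connected_graph (with_proj (ladder m))"
proof -
  interpret L: pair_graph "ladder m" by (rule pair_graph_ladder)
  let ?G = "with_proj (ladder m)"
  have to: "(x, y) \<rightarrow>\<^sup>*\<^bsub>?G\<^esub> (1, 1)" if "x \<in> {1, 2}" "1 \<le> y" "y \<le> m" for x y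
    using that(2,3)
  proof (induction y rule: dec_induct)
    case base
    show ?case
    proof (cases "x = 1")
      case True
      then show ?thesis using assms by (auto intro!: L.reachable_refl simp: pverts_ladder)
    next
      case False
      then have "(x, 1::nat) \<rightarrow>\<^bsub>?G\<^esub> (1, 1)"
        using that(1) assms by (simp add: parcs_ladder pverts_ladder)
      then show ?thesis using L.reachable_adjI by simp
    qed
  next
    case (step y)
    then have "(x, Suc y) \<rightarrow>\<^bsub>?G\<^esub> (x, y)"
      using that(1) by (auto simp: parcs_ladder pverts_ladder)
    then show ?case using step L.adj_reachable_trans by auto
  qed
  have "u \<rightarrow>\<^sup>*\<^bsub>?G\<^esub> v" if "u \<in> pverts (ladder m)" "v \<in> pverts (ladder m)" for u v
  proof -
    have "u \<rightarrow>\<^sup>*\<^bsub>?G\<^esub> (1, 1)" "v \<rightarrow>\<^sup>*\<^bsub>?G\<^esub> (1, 1)"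
      using that to by (auto simp: pverts_ladder)
    then show ?thesis
      using L.reachable_trans L.symmetric_reachable' by blast
  qed
  then have sc: "strongly_connected ?G"
    using assms by (auto simp: strongly_connected_def pverts_ladder)
  have "mk_symmetric ?G = ladder m"
    using L.pair_sym_arcs
    by (intro pair_pre_digraph.equality) (auto simp: mk_symmetric_def symmetric_def dest: symD)
  with sc have "connected ?G"
    by (simp add: connected_def)
  then show ?thesis by unfold_locales
qed

end

theory Submission
  imports Defs
begin

text \<open>
  Lower bound, in any connected graph with two vertices: the endpoints of an edge between two
  parts of a two-part partition both have representation \<open>{0, 1}\<close>. With three parts, among all
  choices of parts \<open>A\<close>, \<open>B\<close>, \<open>C\<close> and a vertex \<open>v\<close> of \<open>B\<close> having a neighbour in \<open>A\<close>,
  minimise \<open>b = d(v, C)\<close>. By minimality a shortest path from \<open>v\<close> to \<open>C\<close> stays in \<open>B\<close> until its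
  last step, and its last vertex in \<open>B\<close> has the same representation \<open>{0, 1, b}\<close> as \<open>v\<close>. So
  \<open>b = 1\<close>, and then a neighbour of \<open>v\<close> in \<open>A\<close> and one in \<open>C\<close> both have representation
  \<open>{0, 1, 2}\<close>.

  Upper bound: the parts \<open>{(1, 1)}\<close>, \<open>{(1, 2), (2, 2)}\<close>, \<open>{(1, 5)}\<close> and the remaining vertices
  resolve the ladder; already the sum and the sum of the squares of the four distances
  determine the vertex.
\<close>

section \<open>Distances to sets of vertices\<close>

context connected_graph
begin

text \<open>Walk lengths are kept as natural numbers, so that distances allow induction and minimal
  choices; for nonempty sets of vertices this is \<open>set_dist\<close>, by
  \<open>set_dist_conv_hop_dist\<close>.\<close>

definition hop_dist :: "'a \<Rightarrow> 'a set \<Rightarrow> nat" where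
  "hop_dist v S = (LEAST n. \<exists>x\<in>S. \<exists>p. awalk v p x \<and> length p = n)"

lemma reachable_verts:
  assumes "u \<in> verts G" "v \<in> verts G"
  shows "u \<rightarrow>\<^sup>* v"
proof -
  have "u \<rightarrow>\<^sup>*\<^bsub>mk_symmetric G\<^esub> v"
    using connected assms by (auto simp: connected_def strongly_connected_def)
  then show ?thesis
    using reachable_mk_symmetric_eq by blast
qed

lemma hop_dist_le: "awalk v p x \<Longrightarrow> x \<in> S \<Longrightarrow> hop_dist v S \<le> length p"
  unfolding hop_dist_def by (rule Least_le) blast

lemma hop_dist_attained:
  assumes "v \<in> verts G" "S \<subseteq> verts G" "S \<noteq> {}"
  obtains x p where "x \<in> S" "awalk v p x" "length p = hop_dist v S"
proof -
  obtain y where "y \<in> S" using assms by blast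
  then obtain q where "awalk v q y"
    using assms reachable_verts reachable_awalk by blast
  with \<open>y \<in> S\<close> have "\<exists>n. \<exists>x\<in>S. \<exists>p. awalk v p x \<and> length p = n" by blast
  from LeastI_ex[OF this] show thesis
    using that unfolding hop_dist_def by blast
qed

lemma hop_dist_eq_0_iff:
  assumes "v \<in> verts G" "S \<subseteq> verts G" "S \<noteq> {}"
  shows "hop_dist v S = 0 \<longleftrightarrow> v \<in> S"
proof
  assume "hop_dist v S = 0"
  with hop_dist_attained[OF assms] show "v \<in> S"
    by (metis awalk_empty_ends length_0_conv)
next
  assume "v \<in> S"
  with hop_dist_le[of v "[]" v S] assms show "hop_dist v S = 0"
    by (simp add: awalk_Nil_iff)
qed

lemma hop_dist_adj:
  assumes "u \<rightarrow> v" "S \<subseteq> verts G" "S \<noteq> {}"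
  shows "hop_dist u S \<le> Suc (hop_dist v S)"
proof -
  obtain x p where p: "x \<in> S" "awalk v p x" "length p = hop_dist v S"
    using hop_dist_attained assms adj_in_verts by metis
  obtain e where "e \<in> arcs G" "tail G e = u" "head G e = v"
    using assms(1) by (auto simp: arcs_ends_conv)
  with p have "awalk u (e # p) x" by (auto simp: awalk_Cons_iff)
  with p show ?thesis using hop_dist_le[of u "e # p" x S] by simp
qed

text \<open>The first arc of a shortest walk to \<open>S\<close> lowers the distance, and by
  \<open>hop_dist_adj\<close> the drop is at most one.\<close>

lemma hop_dist_step:
  assumes "v \<in> verts G" "v \<notin> S" "S \<subseteq> verts G" "S \<noteq> {}"
  obtains w where "v \<rightarrow> w" "hop_dist v S = Suc (hop_dist w S)"
proof -
  obtain x p where p: "x \<in> S" "awalk v p x" "length p = hop_dist v S"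
    using hop_dist_attained assms by metis
  then obtain e q where [simp]: "p = e # q"
    using assms(2) by (cases p) (auto simp: awalk_Nil_iff)
  have e: "e \<in> arcs G" "v = tail G e" "awalk (head G e) q x"
    using p by (auto simp: awalk_Cons_iff)
  then have adj: "v \<rightarrow> head G e" by (auto simp: arcs_ends_conv)
  have "Suc (hop_dist (head G e) S) \<le> hop_dist v S"
    using hop_dist_le[OF e(3) p(1)] p(3) by simp
  with hop_dist_adj[OF adj assms(3,4)] adj that show thesis
    by (metis le_antisym)
qed

text \<open>A certificate for a guessed distance function: vanishing on \<open>S\<close> and
  changing by at most one along arcs makes \<open>f\<close> a lower bound for the length of every
  walk to \<open>S\<close>, while descending along \<open>f\<close> reaches \<open>S\<close> within
  \<open>f v\<close> steps.\<close>

lemma hop_dist_eqI: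
  assumes "v \<in> verts G" "S \<subseteq> verts G" "S \<noteq> {}"
    and zero: "\<And>x. x \<in> S \<Longrightarrow> f x = 0"
    and lipschitz: "\<And>u w. u \<rightarrow> w \<Longrightarrow> f u \<le> Suc (f w)"
    and descent: "\<And>u. u \<in> verts G \<Longrightarrow> u \<notin> S \<Longrightarrow> \<exists>w. u \<rightarrow> w \<and> f w < f u"
  shows "hop_dist v S = f v"
proof (rule antisym)
  show "hop_dist v S \<le> f v"
    using assms(1)
  proof (induction "f v" arbitrary: v rule: less_induct)
    case less
    show ?case
    proof (cases "v \<in> S")
      case True
      with less.prems assms(2,3) show ?thesis using hop_dist_eq_0_iff[of v S] by simp
    next
      case False
      with less.prems descent obtain w where w: "v \<rightarrow> w" "f w < f v" by blast
      then have "hop_dist w S \<le> f w" using less.hyps[of w] adj_in_verts(2) by blast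
      with hop_dist_adj[OF w(1) assms(2,3)] w(2) show ?thesis by simp
    qed
  qed
next
  have walk: "f u \<le> length p" if "awalk u p x" "x \<in> S" for u p x
    using that
  proof (induction p arbitrary: u)
    case Nil
    then show ?case using zero by (simp add: awalk_Nil_iff)
  next
    case (Cons e p)
    then have e: "e \<in> arcs G" "u = tail G e" "awalk (head G e) p x"
      by (auto simp: awalk_Cons_iff)
    then have "u \<rightarrow> head G e" by (auto simp: arcs_ends_conv)
    from lipschitz[OF this] Cons.IH[OF e(3) Cons.prems(2)] show ?case using e(2) by simp
  qed
  from hop_dist_attained[OF assms(1-3)] walk show "f v \<le> hop_dist v S" by metis
qed

section \<open>Representations as multisets of natural numbers\<close>

lemma awalk_cost_one: "awalk_cost (\<lambda>_. 1) p = real (length p)"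
  by (induction p) auto

lemma set_dist_conv_hop_dist:
  assumes "v \<in> verts G" "S \<subseteq> verts G" "S \<noteq> {}"
  shows "set_dist v S = ereal (real (hop_dist v S))"
  unfolding set_dist_def
proof (rule Min_eqI)
  show "finite (vdist v ` S)"
    using finite_subset[OF assms(2)] by simp
next
  have ge: "ereal (real (hop_dist v S)) \<le> vdist v x" if "x \<in> S" for x
    unfolding vdist_def \<mu>_def
    using that hop_dist_le by (auto intro!: INF_greatest simp: awalk_cost_one)
  then show "\<And>y. y \<in> vdist v ` S \<Longrightarrow> ereal (real (hop_dist v S)) \<le> y" by auto
  obtain x p where p: "x \<in> S" "awalk v p x" "length p = hop_dist v S"
    using hop_dist_attained assms by metis
  then have "vdist v x \<le> ereal (real (hop_dist v S))"
    using min_cost_le_walk_cost[OF p(2), of "\<lambda>_. 1"] by (simp add: vdist_def awalk_cost_one)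
  with ge p(1) show "ereal (real (hop_dist v S)) \<in> vdist v ` S"
    by (metis antisym image_eqI)
qed

lemma mp_representation_conv_hop_dist:
  assumes "partition_on (verts G) P" "v \<in> verts G"
  shows "mp_representation P v =
    image_mset (\<lambda>n. ereal (real n)) (image_mset (hop_dist v) (mset_set P))"
  unfolding mp_representation_def multiset.map_comp
proof (rule image_mset_cong)
  fix S assume "S \<in># mset_set P"
  then have "S \<in> P" by (metis elem_mset_set empty_iff mset_set.infinite set_mset_empty)
  then show "set_dist v S = ((\<lambda>n. ereal (real n)) \<circ> hop_dist v) S"
    using assms set_dist_conv_hop_dist
    by (auto simp: partition_on_def)
qed

text \<open>The embedding of the naturals into \<open>ereal\<close> is injective, hence so is the
  map it induces on multisets.\<close>

lemma mp_representation_eq_iff: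
  assumes "partition_on (verts G) P" "u \<in> verts G" "v \<in> verts G"
  shows "mp_representation P u = mp_representation P v \<longleftrightarrow>
    image_mset (hop_dist u) (mset_set P) = image_mset (hop_dist v) (mset_set P)"
proof -
  have "inj (\<lambda>n. ereal (real n))" by (auto simp: inj_def)
  then show ?thesis
    using assms by (simp add: mp_representation_conv_hop_dist inj_eq[OF multiset.inj_map])
qed

section \<open>At least four parts\<close>

lemma resolving_hop_distD:
  assumes "resolving_multiset_partition P" "u \<in> verts G" "v \<in> verts G"
    and "image_mset (hop_dist u) (mset_set P) = image_mset (hop_dist v) (mset_set P)"
  shows "u = v"
  using assms mp_representation_eq_iff unfolding resolving_multiset_partition_def by metis

lemma hop_dist_eq_1I:
  assumes "u \<rightarrow> v" "v \<in> S" "u \<notin> S" "S \<subseteq> verts G"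
  shows "hop_dist u S = 1"
proof -
  have "hop_dist v S = 0" "hop_dist u S \<noteq> 0"
    using assms hop_dist_eq_0_iff adj_in_verts by blast+
  with hop_dist_adj[of u v S] assms show ?thesis by fastforce
qed

text \<open>Walking from \<open>v\<close> towards \<open>S\<close>, the last vertex before
  \<open>S\<close> is entered has distance 1.\<close>

lemma ex_hop_dist_eq_1:
  assumes "v \<in> verts G" "v \<notin> S" "S \<subseteq> verts G" "S \<noteq> {}"
  shows "\<exists>w \<in> verts G. hop_dist w S = 1"
  using assms(1,2)
proof (induction "hop_dist v S" arbitrary: v)
  case 0
  then show ?case using hop_dist_eq_0_iff assms(3,4) by metis
next
  case (Suc n)
  then obtain w where w: "v \<rightarrow> w" "hop_dist v S = Suc (hop_dist w S)"
    using hop_dist_step assms(3,4) by metis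
  show ?case
  proof (cases "w \<in> S")
    case True
    with w Suc.prems assms show ?thesis using hop_dist_eq_1I by blast
  next
    case False
    with w Suc show ?thesis using adj_in_verts by force
  qed
qed

lemma not_resolving_two_parts: "\<not> resolving_multiset_partition {A, B}" if "A \<noteq> B"
proof
  assume res: "resolving_multiset_partition {A, B}"
  then have part: "A \<subseteq> verts G" "B \<subseteq> verts G" "A \<noteq> {}" "B \<noteq> {}" "A \<inter> B = {}"
    "verts G = A \<union> B"
    using \<open>A \<noteq> B\<close>
    by (auto simp: resolving_multiset_partition_def partition_on_def disjoint_def)
  obtain z where "z \<in> B" using part by blast
  with part have "z \<in> verts G" "z \<notin> A" by auto
  then obtain v where v: "v \<in> verts G" "hop_dist v A = 1"
    using ex_hop_dist_eq_1 part(1,3) by blast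
  then have "v \<in> B" "v \<notin> A"
    using part hop_dist_eq_0_iff[of v A] by auto
  obtain u where u: "v \<rightarrow> u" "hop_dist u A = 0"
    using hop_dist_step[of v A] v part \<open>v \<notin> A\<close> by (metis One_nat_def Suc_inject)
  then have "u \<in> A"
    using hop_dist_eq_0_iff[OF adj_in_verts(2)[OF u(1)] part(1,3)] by simp
  have "u \<rightarrow> v" using u(1) by (rule graph_symmetric)
  then have "hop_dist u B = 1"
    using hop_dist_eq_1I[of u v B] \<open>u \<in> A\<close> \<open>v \<in> B\<close> part(2,5) by blast
  moreover have "hop_dist v B = 0"
    using hop_dist_eq_0_iff[OF v(1) part(2,4)] \<open>v \<in> B\<close> by simp
  ultimately have "image_mset (hop_dist u) (mset_set {A, B}) = image_mset (hop_dist v) (mset_set {A, B})"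
    using u v \<open>A \<noteq> B\<close> by simp
  then have "u = v"
    using resolving_hop_distD[OF res adj_in_verts(2)[OF u(1)] v(1)] by simp
  with \<open>u \<in> A\<close> \<open>v \<notin> A\<close> show False by simp
qed

lemma not_resolving_three_parts:
  assumes "card P = 3"
  shows "\<not> resolving_multiset_partition P"
proof
  assume res: "resolving_multiset_partition P"
  then have part: "partition_on (verts G) P" by (simp add: resolving_multiset_partition_def)
  define parts where "parts A B C \<longleftrightarrow> P = {A, B, C} \<and> A \<noteq> B \<and> A \<noteq> C \<and> B \<noteq> C" for A B C
  \<comment> \<open>The quantifiers range over all assignments of the roles \<open>A\<close>,
    \<open>B\<close>, \<open>C\<close> to the three parts, so the minimal \<open>b\<close> chosen
    below remains a bound after any exchange of roles.\<close>
  define border where "border b \<longleftrightarrow>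
    (\<exists>A B C v. parts A B C \<and> v \<in> B \<and> hop_dist v A = 1 \<and> hop_dist v C = b)" for b
  have perm: "parts B A C" "parts C B A" if "parts A B C" for A B C
    using that by (auto simp: parts_def)
  have sub: "S \<subseteq> verts G" "S \<noteq> {}" if "S \<in> P" for S
    using that part by (auto simp: partition_on_def)
  have mem: "x \<in> verts G" if "x \<in> S" "S \<in> P" for x S
    using that sub by blast
  have cover: "x \<in> A \<or> x \<in> B \<or> x \<in> C" if "parts A B C" "x \<in> verts G" for A B C x
  proof -
    have "x \<in> \<Union> P" using that(2) part by (simp add: partition_on_def)
    then show ?thesis using that(1) by (auto simp: parts_def)
  qed
  have disj: "A \<inter> B = {}" "A \<inter> C = {}" "B \<inter> C = {}" "A \<in> P" "B \<in> P" "C \<in> P"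
    if "parts A B C" for A B C
  proof -
    show P: "A \<in> P" "B \<in> P" "C \<in> P" using that by (auto simp: parts_def)
    have "disjoint P" using part by (simp add: partition_on_def)
    then show "A \<inter> B = {}" "A \<inter> C = {}" "B \<inter> C = {}"
      using P that disjointD unfolding parts_def by blast+
  qed
  have dist0: "hop_dist v S = 0 \<longleftrightarrow> v \<in> S" if "v \<in> verts G" "S \<in> P" for v S
    using that sub hop_dist_eq_0_iff by blast
  have rep: "image_mset (hop_dist v) (mset_set P) = {#hop_dist v A, hop_dist v B, hop_dist v C#}"
    if "parts A B C" for A B C v
    using that by (auto simp: parts_def)
  have uniq: "u = v" if "parts A B C" "u \<in> verts G" "v \<in> verts G"
    "{#hop_dist u A, hop_dist u B, hop_dist u C#} = {#hop_dist v A, hop_dist v B, hop_dist v C#}"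
    for A B C u v
    using resolving_hop_distD[OF res that(2,3)] rep[OF that(1)] that(4) by simp

  obtain A0 B0 C0 where p0: "parts A0 B0 C0"
    using assms unfolding parts_def card_3_iff by blast
  obtain z where "z \<in> B0" using sub(2) disj[OF p0] by blast
  then have "z \<in> verts G" "z \<notin> A0" using mem disj[OF p0] by blast+
  then obtain w where w: "w \<in> verts G" "hop_dist w A0 = 1"
    using ex_hop_dist_eq_1[OF _ _ sub[OF disj(4)[OF p0]]] by blast
  then have "w \<in> B0 \<or> w \<in> C0"
    using cover[OF p0 w(1)] dist0[OF w(1) disj(4)[OF p0]] by auto
  \<comment> \<open>If \<open>w\<close> lies in \<open>C0\<close>, the names \<open>B0\<close> and
    \<open>C0\<close> are exchanged.\<close>
  moreover have "parts A0 C0 B0" using p0 by (auto simp: parts_def)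
  ultimately have "\<exists>b. border b" using p0 w unfolding border_def by blast
  define b where "b = (LEAST b. border b)"
  have "border b"
    unfolding b_def by (rule LeastI_ex) fact
  have minimal: "b \<le> b'" if "border b'" for b'
    using that by (simp add: b_def Least_le)
  obtain A B C v where p: "parts A B C" and v: "v \<in> B" "hop_dist v A = 1" "hop_dist v C = b"
    using \<open>border b\<close> unfolding border_def by blast
  note d = disj[OF p]
  have vV: "v \<in> verts G" using v mem d by blast
  have "b \<noteq> 0" using dist0[OF vV d(6)] d(3) v(1,3) by auto
  have B0: "hop_dist x B = 0" if "x \<in> B" for x
    using that dist0[OF mem[OF that d(5)] d(5)] by simp

  \<comment> \<open>After \<open>t\<close> steps from \<open>v\<close> towards \<open>C\<close> the
    walk is still in \<open>B\<close>; each step takes it at most one further from \<open>A\<close>,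
    which started at distance 1.\<close>
  have path: "\<exists>q \<in> B. hop_dist q C = b - t \<and> hop_dist q A \<le> Suc t" if "t < b" for t
    using that
  proof (induction t)
    case 0
    then show ?case using v by auto
  next
    case (Suc t)
    then obtain q where q: "q \<in> B" "hop_dist q C = b - t" "hop_dist q A \<le> Suc t" by auto
    have "q \<notin> C" using q(1) d(3) by blast
    then obtain r where r: "q \<rightarrow> r" "hop_dist q C = Suc (hop_dist r C)"
      using hop_dist_step[OF mem[OF q(1) d(5)] _ sub[OF d(6)]] by blast
    have rV: "r \<in> verts G" using r(1) by (rule adj_in_verts)
    have rC: "hop_dist r C = b - Suc t" using q r by simp
    then have "r \<notin> C" using dist0[OF rV d(6)] Suc.prems by auto
    have sym: "r \<rightarrow> q" using r(1) by (rule graph_symmetric)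
    \<comment> \<open>A vertex \<open>r\<close> of \<open>A\<close> would have its neighbour
      \<open>q\<close> in \<open>B\<close>; with \<open>A\<close> and \<open>B\<close> exchanged it
      would be a border vertex closer to \<open>C\<close> than the minimum allows.\<close>
    have "r \<notin> A"
    proof
      assume "r \<in> A"
      then have "hop_dist r B = 1"
        using hop_dist_eq_1I[OF sym q(1) _ sub(1)[OF d(5)]] d(1) by blast
      then have "border (b - Suc t)"
        unfolding border_def using perm(1)[OF p] \<open>r \<in> A\<close> rC by blast
      then show False using minimal[of "b - Suc t"] Suc.prems by simp
    qed
    with \<open>r \<notin> C\<close> cover[OF p rV] have "r \<in> B" by blast
    moreover have "hop_dist r A \<le> Suc (hop_dist q A)"
      using hop_dist_adj[OF sym sub[OF d(4)]] .
    ultimately show ?case using rC q(3) by force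
  qed
  \<comment> \<open>The choice \<open>t = b - 1\<close> gives the last vertex of the path inside
    \<open>B\<close>.\<close>
  obtain q where q: "q \<in> B" "hop_dist q C = 1" "hop_dist q A \<le> b"
    using path[of "b - 1"] \<open>b \<noteq> 0\<close> by auto
  \<comment> \<open>With \<open>A\<close> and \<open>C\<close> exchanged, minimality turns the bound
    \<open>hop_dist q A \<le> b\<close> into an equality, so \<open>q\<close> and \<open>v\<close>
    share the distances 0, 1, \<open>b\<close>.\<close>
  have "border (hop_dist q A)"
    unfolding border_def using perm(2)[OF p] q by blast
  with q minimal have "hop_dist q A = b" by (simp add: antisym)
  then have "q = v"
    using uniq[OF p mem[OF q(1) d(5)] vV] q v B0 \<open>hop_dist q A = b\<close> by simp
  with q v have "b = 1" by simp

  have "\<exists>u \<in> S. v \<rightarrow> u" if one: "hop_dist v S = 1" and S: "S \<in> P" for S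
  proof -
    have "v \<notin> S" using one dist0[OF vV S] by simp
    then obtain u where u: "v \<rightarrow> u" "hop_dist v S = Suc (hop_dist u S)"
      using hop_dist_step[OF vV _ sub[OF S]] by blast
    then show ?thesis using one dist0[OF adj_in_verts(2)[OF u(1)] S] by auto
  qed
  then obtain u w where u: "u \<in> A" "v \<rightarrow> u" and w: "w \<in> C" "v \<rightarrow> w"
    using v(2,3) \<open>b = 1\<close> d(4,6) by meson
  have V: "u \<in> verts G" "w \<in> verts G" using u(2) w(2) adj_in_verts(2) by blast+
  have adj: "u \<rightarrow> v" "w \<rightarrow> v" using u(2) w(2) graph_symmetric by blast+
  have "u \<notin> B" "w \<notin> B" "u \<notin> C" "w \<notin> A" "v \<notin> A" "v \<notin> C"
    using u(1) w(1) v(1) d(1-3) by blast+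
  then have "hop_dist u B = 1" "hop_dist w B = 1"
    using hop_dist_eq_1I[OF _ v(1) _ sub(1)[OF d(5)]] adj by blast+
  moreover have "hop_dist u A = 0" "hop_dist w C = 0"
    using dist0[OF V(1) d(4)] dist0[OF V(2) d(6)] u(1) w(1) by blast+
  moreover have "hop_dist u C \<le> 2" "hop_dist w A \<le> 2"
    using hop_dist_adj[OF adj(1) sub[OF d(6)]] hop_dist_adj[OF adj(2) sub[OF d(4)]] v(2,3) \<open>b = 1\<close>
    by linarith+
  moreover have "hop_dist u C \<noteq> 0" "hop_dist w A \<noteq> 0"
    using dist0[OF V(1) d(6)] dist0[OF V(2) d(4)] \<open>u \<notin> C\<close> \<open>w \<notin> A\<close> by blast+
  moreover have "u \<noteq> v" "w \<noteq> v" "u \<noteq> w"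
    using u(1) w(1) \<open>u \<notin> C\<close> \<open>v \<notin> A\<close> \<open>v \<notin> C\<close> by blast+
  \<comment> \<open>Distance 1 would give \<open>u\<close> or \<open>w\<close> the distances 0, 1, 1
    of \<open>v\<close>; only 2 is left, because the path through \<open>v\<close> has length
    2.\<close>
  then have "hop_dist u C \<noteq> 1" "hop_dist w A \<noteq> 1"
    using uniq[OF p V(1) vV] uniq[OF p V(2) vV] calculation v \<open>b = 1\<close> B0
    by (auto simp: add_mset_commute)
  ultimately have "hop_dist u C = 2" "hop_dist w A = 2" by linarith+
  then have "u = w"
    using uniq[OF p V] \<open>hop_dist u B = 1\<close> \<open>hop_dist w B = 1\<close> \<open>hop_dist u A = 0\<close> \<open>hop_dist w C = 0\<close>
    by (simp add: add_mset_commute)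
  with \<open>u \<noteq> w\<close> show False by simp
qed

lemma card_resolving_ge_4:
  assumes "resolving_multiset_partition P" "card (verts G) \<ge> 2"
  shows "card P \<ge> 4"
proof -
  have fin: "finite P" and part: "partition_on (verts G) P"
    using assms by (auto simp: resolving_multiset_partition_def)
  have "card P \<noteq> 0"
    using assms(2) fin part by (auto simp: partition_on_def)
  moreover have "card P \<noteq> 1"
  proof
    assume "card P = 1"
    then obtain A where "P = {A}" using card_1_singletonE by blast
    with part have P: "P = {verts G}" and ne: "verts G \<noteq> {}" by (auto simp: partition_on_def)
    \<comment> \<open>With a single part every vertex has the representation consisting of one
      0.\<close>
    have "u = v" if "u \<in> verts G" "v \<in> verts G" for u v
      using resolving_hop_distD[OF assms(1) that] that hop_dist_eq_0_iff[of _ "verts G"] ne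
      by (simp add: P)
    then have "card (verts G) \<le> 1" by (simp add: card_le_Suc0_iff_eq)
    with assms(2) show False by simp
  qed
  moreover have "card P \<noteq> 2"
    using not_resolving_two_parts assms(1) by (auto simp: card_2_iff)
  moreover have "card P \<noteq> 3"
    using not_resolving_three_parts assms(1) by blast
  ultimately show ?thesis by linarith
qed

end

section \<open>Four parts for the ladder\<close>

lemma ladder_arc_iff:
  "((x, y) \<rightarrow>\<^bsub>with_proj (ladder m)\<^esub> (x', y')) \<longleftrightarrow>
    x \<in> {1, 2} \<and> x' \<in> {1, 2} \<and> y \<in> {1..m} \<and> y' \<in> {1..m} \<and>
    (x = x' \<and> (y' = Suc y \<or> y = Suc y') \<or> x \<noteq> x' \<and> y = y')"
  by (auto simp: parcs_ladder pverts_ladder)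

text \<open>The certificate \<open>hop_dist_eqI\<close> in coordinates: rungs and row edges are
  checked separately, and \<open>3 - a\<close> is the row opposite to \<open>a\<close>.\<close>

lemma ladder_hop_dist_eqI:
  assumes "x \<in> {1, 2}" "y \<in> {1..m}" "S \<subseteq> {1, 2} \<times> {1..m}" "S \<noteq> {}"
    and zero: "\<And>a b. (a, b) \<in> S \<Longrightarrow> f a b = 0"
    and vert: "\<And>b. b \<in> {1..m} \<Longrightarrow> f 1 b \<le> Suc (f 2 b) \<and> f 2 b \<le> Suc (f 1 b)"
    and horiz: "\<And>a b. a \<in> {1, 2} \<Longrightarrow> b \<in> {1..m} \<Longrightarrow>
      f a b \<le> Suc (f a (Suc b)) \<and> f a (Suc b) \<le> Suc (f a b)"
    and descent: "\<And>a b. (a, b) \<notin> S \<Longrightarrow> a \<in> {1, 2} \<Longrightarrow> b \<in> {1..m} \<Longrightarrow>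
      f (3 - a) b < f a b \<or> (b < m \<and> f a (Suc b) < f a b) \<or> (1 < b \<and> f a (b - 1) < f a b)"
  shows "connected_graph.hop_dist (with_proj (ladder m)) (x, y) S = f x y"
proof -
  interpret L: connected_graph "with_proj (ladder m)"
    using assms(2) by (intro connected_graph_ladder) simp
  have "L.hop_dist (x, y) S = (\<lambda>(a, b). f a b) (x, y)"
  proof (rule L.hop_dist_eqI)
    show "(x, y) \<in> verts (with_proj (ladder m))" "S \<subseteq> verts (with_proj (ladder m))" "S \<noteq> {}"
      using assms(1-4) by (auto simp: pverts_ladder)
    show "(case z of (a, b) \<Rightarrow> f a b) = 0" if "z \<in> S" for z
      using that zero by (cases z) simp
    show "(case u of (a, b) \<Rightarrow> f a b) \<le> Suc (case w of (a, b) \<Rightarrow> f a b)"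
      if "u \<rightarrow>\<^bsub>with_proj (ladder m)\<^esub> w" for u w
    proof -
      obtain a b a' b' where [simp]: "u = (a, b)" "w = (a', b')" by (cases u, cases w)
      have "a \<in> {1, 2}" "a' \<in> {1, 2}" "b \<in> {1..m}" "b' \<in> {1..m}"
        "a = a' \<and> (b' = Suc b \<or> b = Suc b') \<or> a \<noteq> a' \<and> b = b'"
        using that[unfolded \<open>u = (a, b)\<close> \<open>w = (a', b')\<close> ladder_arc_iff] by blast+
      then show ?thesis using vert[of b] horiz[of a b] horiz[of a b'] by auto
    qed
    show "\<exists>w. u \<rightarrow>\<^bsub>with_proj (ladder m)\<^esub> w \<and>
        (case w of (a, b) \<Rightarrow> f a b) < (case u of (a, b) \<Rightarrow> f a b)"
      if "u \<in> verts (with_proj (ladder m))" "u \<notin> S" for u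
    proof -
      have "u \<in> {1, 2} \<times> {1..m}" using that(1) by (simp add: pverts_ladder)
      then obtain a b where u: "u = (a, b)" "a \<in> {1, 2}" "b \<in> {1..m}" by blast
      have "(a, b) \<rightarrow>\<^bsub>with_proj (ladder m)\<^esub> (3 - a, b)"
        "b < m \<Longrightarrow> (a, b) \<rightarrow>\<^bsub>with_proj (ladder m)\<^esub> (a, Suc b)"
        "1 < b \<Longrightarrow> (a, b) \<rightarrow>\<^bsub>with_proj (ladder m)\<^esub> (a, b - 1)"
        using u(2,3) by (subst ladder_arc_iff; auto)+
      moreover have "f (3 - a) b < f a b \<or> (b < m \<and> f a (Suc b) < f a b) \<or>
          (1 < b \<and> f a (b - 1) < f a b)"
        using descent u that(2) by simp
      ultimately show ?thesis unfolding u(1) by fastforce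
    qed
  qed
  then show ?thesis by simp
qed

definition rest :: "nat \<Rightarrow> (nat \<times> nat) set" where
  "rest m = {1, 2} \<times> {1..m} - {(1, 1), (1, 2), (2, 2), (1, 5)}"

text \<open>With truncated subtraction, \<open>(y - c) + (c - y)\<close> is the distance of columns \<open>y\<close> and \<open>c\<close>.\<close>

lemma ladder_hop_dist:
  assumes "m \<ge> 5" "x \<in> {1, 2}" "y \<in> {1..m}"
  shows "connected_graph.hop_dist (with_proj (ladder m)) (x, y) {(1, 1)} = (x - 1) + (y - 1)"
    and "connected_graph.hop_dist (with_proj (ladder m)) (x, y) {(1, 2), (2, 2)} =
      (y - 2) + (2 - y)"
    and "connected_graph.hop_dist (with_proj (ladder m)) (x, y) {(1, 5)} =
      (x - 1) + ((y - 5) + (5 - y))"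
    and "connected_graph.hop_dist (with_proj (ladder m)) (x, y) (rest m) =
      (if (x, y) \<in> rest m then 0 else 1)"
proof -
  show "connected_graph.hop_dist (with_proj (ladder m)) (x, y) {(1, 1)} = (x - 1) + (y - 1)"
    by (rule ladder_hop_dist_eqI) (use assms in auto)
  show "connected_graph.hop_dist (with_proj (ladder m)) (x, y) {(1, 2), (2, 2)} =
      (y - 2) + (2 - y)"
    by (rule ladder_hop_dist_eqI[where f = "\<lambda>x y. (y - 2) + (2 - y)"])
      (use assms in auto)
  show "connected_graph.hop_dist (with_proj (ladder m)) (x, y) {(1, 5)} =
      (x - 1) + ((y - 5) + (5 - y))"
    by (rule ladder_hop_dist_eqI[where f = "\<lambda>x y. (x - 1) + ((y - 5) + (5 - y))"])
      (use assms in auto)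
  \<comment> \<open>The vertices outside \<open>rest m\<close> all have a neighbour in it:
    \<open>(2, 1)\<close> serves \<open>(1, 1)\<close> and \<open>(2, 2)\<close>,
    \<open>(1, 3)\<close> serves \<open>(1, 2)\<close>, and \<open>(2, 5)\<close> serves
    \<open>(1, 5)\<close>. Hence the distance is the indicator of these four vertices.\<close>
  have "(2, 1) \<in> rest m" using assms by (simp add: rest_def)
  then have "rest m \<noteq> {}" by blast
  then show "connected_graph.hop_dist (with_proj (ladder m)) (x, y) (rest m) =
      (if (x, y) \<in> rest m then 0 else 1)"
    by (intro ladder_hop_dist_eqI[where f = "\<lambda>x y. if (x, y) \<in> rest m then 0 else 1"])
      (use assms in \<open>auto simp: rest_def\<close>)
qed

section \<open>Power sums of the four distances\<close>

text \<open>The power sum of exponent \<open>e\<close> of the four distances, in closed form. Being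
  symmetric in them, it depends only on the representation, and comparing multisets reduces to
  comparing numbers.\<close>

definition moment :: "nat \<Rightarrow> nat \<Rightarrow> nat \<Rightarrow> nat" where
  "moment e x y = ((x - 1) + (y - 1)) ^ e + ((y - 2) + (2 - y)) ^ e +
    ((x - 1) + ((y - 5) + (5 - y))) ^ e +
    (if (x, y) \<in> {(1, 1), (1, 2), (2, 2), (1, 5)} then 1 else 0) ^ e"

text \<open>From column \<open>6\<close> on, the first moments of the two rows are \<open>3 y - 8\<close> and \<open>3 y - 6\<close>, which
  differ modulo \<open>3\<close>; the second moment only has to separate the first five columns.\<close>

lemma moments_determine_vertex:
  assumes "x \<in> {1, 2}" "x' \<in> {1, 2}" "y \<ge> 1" "y' \<ge> 1"
    and "moment 1 x y = moment 1 x' y'" "moment 2 x y = moment 2 x' y'"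
  shows "(x, y) = (x', y')"
proof -
  have row1: "moment 1 1 k = 3 * k - 8" and row2: "moment 1 2 k = 3 * k - 6" if "k \<ge> 6" for k
    using that by (auto simp: moment_def)
  have cols: "k \<in> {1, 2, 3, 4, 5} \<or> k \<ge> 6" if "k \<ge> 1" for k :: nat
    using that by auto
  have small: "moment 1 1 1 = 6" "moment 1 1 2 = 5" "moment 1 1 3 = 5" "moment 1 1 4 = 6" "moment 1 1 5 = 8"
    "moment 1 2 1 = 7" "moment 1 2 2 = 7" "moment 1 2 3 = 7" "moment 1 2 4 = 8" "moment 1 2 5 = 9"
    "moment 2 1 1 = 18" "moment 2 1 2 = 11" "moment 2 1 3 = 9" "moment 2 1 4 = 14" "moment 2 1 5 = 26"
    "moment 2 2 1 = 27" "moment 2 2 2 = 21" "moment 2 2 3 = 19" "moment 2 2 4 = 24" "moment 2 2 5 = 35"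
    by (simp_all add: moment_def power2_eq_square)
  show ?thesis
  proof (cases "y \<ge> 6 \<or> y' \<ge> 6")
    case True
    \<comment> \<open>The threshold is sharp: \<open>(1, 6)\<close> has first moment 10, and the
      largest value in the first five columns is 9, at \<open>(2, 5)\<close>. Thus equal first
      moments put both vertices on the same side of column 6.\<close>
    have far: "moment 1 a k \<ge> 10" if "a \<in> {1, 2}" "k \<ge> 6" for a k
      using that row1[of k] row2[of k] by auto
    have near: "moment 1 a k \<le> 9" if "a \<in> {1, 2}" "k \<in> {1, 2, 3, 4, 5}" for a k
      using that small by auto
    have "k \<ge> 6 \<longleftrightarrow> moment 1 a k \<ge> 10" if "a \<in> {1, 2}" "k \<ge> 1" for a k
      using far[of a k] near[of a k] cols[of k] that by linarith
    then have "y \<ge> 6" "y' \<ge> 6"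
      using True assms(1-5) by metis+
    then show ?thesis
      using assms(1,2,5) row1[of y] row2[of y] row1[of y'] row2[of y'] by auto presburger+
  next
    case False
    then have "y \<in> {1, 2, 3, 4, 5}" "y' \<in> {1, 2, 3, 4, 5}"
      using cols assms(3,4) by blast+
    moreover have "inj_on (\<lambda>(a, k). (moment 1 a k, moment 2 a k)) ({1, 2} \<times> {1, 2, 3, 4, 5})"
      by (simp add: inj_on_def small[simplified One_nat_def])
    ultimately show ?thesis
      using assms(1,2,5,6) by (elim inj_onD) auto
  qed
qed

text \<open>Equal representations have equal power sums for every exponent, and exponents 1 and 2
  already identify the vertex by \<open>moments_determine_vertex\<close>.\<close>

lemma ladder_resolving:
  assumes "m \<ge> 5"
  defines "P \<equiv> {{(1, 1)}, {(1, 2), (2, 2)}, {(1, 5)}, rest m}"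
  shows "connected_graph.resolving_multiset_partition (with_proj (ladder m)) P"
    and "card P = 4"
proof -
  interpret L: connected_graph "with_proj (ladder m)"
    using assms(1) by (intro connected_graph_ladder) simp
  have "(2, 1) \<in> rest m"
    using assms(1) by (simp add: rest_def)
  then have ne: "rest m \<noteq> {(1, 1)}" "rest m \<noteq> {(1, 2), (2, 2)}" "rest m \<noteq> {(1, 5)}" "rest m \<noteq> {}"
    by fastforce+
  have P: "mset_set P = {#{(1, 1)}, {(1, 2), (2, 2)}, {(1, 5)}, rest m#}"
    \<comment> \<open>The four parts are pairwise distinct, so \<open>mset_set\<close> lists four
      entries; its size then gives the cardinality.\<close>
    unfolding P_def using ne[symmetric] by (simp add: doubleton_eq_iff)
  show "card P = 4"
    using arg_cong[OF P, of size] by simp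
  have part: "partition_on (verts (with_proj (ladder m))) P"
  proof (rule partition_onI)
    show "\<Union> P = verts (with_proj (ladder m))"
      using assms(1) by (auto simp: P_def pverts_ladder rest_def)
    show "disjnt p q" if "p \<in> P" "q \<in> P" "p \<noteq> q" for p q
      using that by (auto simp: P_def rest_def disjnt_def)
    show "{} \<notin> P"
      using ne(4) by (auto simp: P_def)
  qed
  have moment: "(\<Sum>n\<in>#image_mset (L.hop_dist (a, b)) (mset_set P). n ^ e) = moment e a b"
    if "a \<in> {1, 2}" "b \<in> {1..m}" for a b e
  proof -
    \<comment> \<open>This matches the distance to \<open>rest m\<close> with the last summand of
      \<open>moment\<close>.\<close>
    have "(a, b) \<in> rest m \<longleftrightarrow> (a, b) \<notin> {(1, 1), (1, 2), (2, 2), (1, 5)}"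
      using that by (simp add: rest_def)
    then show ?thesis
      unfolding P image_mset_add_mset ladder_hop_dist[OF assms(1) that] moment_def by simp
  qed
  have "u = v" if u: "u \<in> verts (with_proj (ladder m))" and v: "v \<in> verts (with_proj (ladder m))"
    and eq: "L.mp_representation P u = L.mp_representation P v" for u v
  proof -
    obtain x y x' y' where uv: "u = (x, y)" "v = (x', y')"
      and bounds: "x \<in> {1, 2}" "x' \<in> {1, 2}" "y \<in> {1..m}" "y' \<in> {1..m}"
      using u v by (cases u, cases v) (auto simp: pverts_ladder)
    have "image_mset (L.hop_dist u) (mset_set P) = image_mset (L.hop_dist v) (mset_set P)"
      using L.mp_representation_eq_iff[OF part u v] eq by simp
    from arg_cong[OF this, of "\<lambda>M. \<Sum>n\<in>#M. n ^ e" for e]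
    have "moment e x y = moment e x' y'" for e
      using moment bounds by (simp add: uv)
    then have "(x, y) = (x', y')"
      using bounds by (intro moments_determine_vertex) auto
    then show ?thesis by (simp add: uv)
  qed
  with part show "L.resolving_multiset_partition P"
    unfolding L.resolving_multiset_partition_def by (auto simp: P_def)
qed

theorem theorem3p4:
  fixes m :: nat
  assumes "m \<ge> 5"
  shows "connected_graph.mpd (with_proj (ladder m)) = 4"
proof -
  interpret L: connected_graph "with_proj (ladder m)"
    using assms by (intro connected_graph_ladder) simp
  have "card (verts (with_proj (ladder m))) \<ge> 2"
    using assms by (simp add: pverts_ladder card_cartesian_product)
  then have "enat 4 \<le> L.mpd"
    unfolding L.mpd_def using L.card_resolving_ge_4 by (auto intro!: INF_greatest)
  moreover have "L.mpd \<le> enat 4"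
    unfolding L.mpd_def using ladder_resolving[OF assms] by (metis INF_lower mem_Collect_eq)
  ultimately show ?thesis
    by (simp add: numeral_eq_enat)
qed

end
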